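(* Let $\mathcal{Q}$ be a locally compact space endowed with a positive Radon measure $\mu$. For any symmetric operator $H$ on $\mathsf{L}^2(\mathcal{Q},\mu)$, with domain $\mathsf{D}(H)$, having an eigenvalue $e_0$ whose corresponding eigenfunction $\Phi_0\in\mathsf{D}(H)$ is real and nonnegative almost everywhere (with respect to $\mu$) on $\mathcal{Q}$, we have $$\forall\varphi\in\mathsf{D}(H)\ \text{such that}\ \Re(\varphi)\geqslant0,\qquad \inf_{\mathcal{Q}}(E_\varphi)\leqslant e_0\leqslant\sup_{\mathcal{Q}}(E_\varphi).$$
   Context: $\mathsf{L}^2(\mathcal{Q},\mu)$ is the Hilbert space of square-integrable complex functions on $\mathcal{Q}$, with scalar product $\langle\psi|\varphi\rangle=\int_{\mathcal{Q}}\overline{\psi}(q)\,\varphi(q)\,d\mu(q)$. For any $\varphi$ in $\mathsf{D}(H)$, the local energy is the function $E_\varphi:\mathcal{Q}\to\overline{\mathbb{R}}$ (the extended real line) defined by $$E_\varphi(q)=\frac{\Re\big(H\varphi(q)\big)}{\Re\big(\varphi(q)\big)}.$$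
   Formalization: The local energy is undefined where it reads 0/0 (e.g. for φ = 0); the inf and sup are taken over points where it is defined, and φ is assumed such that these points meet {Φ₀ ≠ 0} in a non-null set, which is automatic when the local energy is defined almost everywhere. *)

theory Defs
  imports "HOL-Analysis.Analysis"
begin

definition radon_measure :: "'a::topological_space measure \<Rightarrow> bool" where
  "radon_measure M \<longleftrightarrow>
     sets M = sets borel \<and>
     (\<forall>K. compact K \<longrightarrow> emeasure M K < \<infinity>) \<and>
     (\<forall>B\<in>sets M. emeasure M B = (INF U\<in>{U. open U \<and> B \<subseteq> U}. emeasure M U)) \<and>
     (\<forall>U. open U \<longrightarrow> emeasure M U = (SUP K\<in>{K. compact K \<and> K \<subseteq> U}. emeasure M K))"

(* Elements of the Hilbert space are handled through their representatives: functions that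
   agree almost everywhere stand for the same vector, and everything below respects this. *)

definition L2 :: "'a measure \<Rightarrow> ('a \<Rightarrow> complex) set" where
  "L2 M = {f \<in> borel_measurable M. integrable M (\<lambda>q. (cmod (f q))\<^sup>2)}"

definition L2_inner :: "'a measure \<Rightarrow> ('a \<Rightarrow> complex) \<Rightarrow> ('a \<Rightarrow> complex) \<Rightarrow> complex" where
  "L2_inner M \<psi> \<phi> = (LINT q|M. cnj (\<psi> q) * \<phi> q)"

(* A linear operator H defined on a subspace D of the Hilbert space. The domain is saturated
   under almost-everywhere equality, and H maps equal vectors to equal vectors; which
   representative H picks for the image vector is left unconstrained. *)
definition L2_operator ::
    "'a measure \<Rightarrow> ('a \<Rightarrow> complex) set \<Rightarrow> (('a \<Rightarrow> complex) \<Rightarrow> 'a \<Rightarrow> complex) \<Rightarrow> bool" where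
  "L2_operator M D H \<longleftrightarrow>
     D \<subseteq> L2 M \<and> (\<lambda>_. 0) \<in> D \<and>
     (\<forall>f\<in>D. \<forall>g\<in>D. (\<lambda>q. f q + g q) \<in> D) \<and>
     (\<forall>c. \<forall>f\<in>D. (\<lambda>q. c * f q) \<in> D) \<and>
     (\<forall>f\<in>D. \<forall>g\<in>L2 M. (AE q in M. f q = g q) \<longrightarrow> g \<in> D) \<and>
     (\<forall>f\<in>D. H f \<in> L2 M) \<and>
     (\<forall>f\<in>D. \<forall>g\<in>D. (AE q in M. f q = g q) \<longrightarrow> (AE q in M. H f q = H g q)) \<and>
     (\<forall>f\<in>D. \<forall>g\<in>D. AE q in M. H (\<lambda>q. f q + g q) q = H f q + H g q) \<and>
     (\<forall>c. \<forall>f\<in>D. AE q in M. H (\<lambda>q. c * f q) q = c * H f q)"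

definition symmetric_operator ::
    "'a measure \<Rightarrow> ('a \<Rightarrow> complex) set \<Rightarrow> (('a \<Rightarrow> complex) \<Rightarrow> 'a \<Rightarrow> complex) \<Rightarrow> bool" where
  "symmetric_operator M D H \<longleftrightarrow>
     L2_operator M D H \<and> (\<forall>\<psi>\<in>D. \<forall>\<phi>\<in>D. L2_inner M \<psi> (H \<phi>) = L2_inner M (H \<psi>) \<phi>)"

definition is_eigenfunction ::
    "'a measure \<Rightarrow> ('a \<Rightarrow> complex) set \<Rightarrow> (('a \<Rightarrow> complex) \<Rightarrow> 'a \<Rightarrow> complex) \<Rightarrow> complex
       \<Rightarrow> ('a \<Rightarrow> complex) \<Rightarrow> bool" where
  "is_eigenfunction M D H e \<Phi> \<longleftrightarrow>
     \<Phi> \<in> D \<and> \<not> (AE q in M. \<Phi> q = 0) \<and> (AE q in M. H \<Phi> q = e * \<Phi> q)"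

(* Division of extended reals gives x / 0 = \<infinity> for x > 0 and x / 0 = - \<infinity> for x < 0, as required;
   it also gives 0 / 0 = 0, but such points are left out of local_energy_domain. *)
definition local_energy ::
    "(('a \<Rightarrow> complex) \<Rightarrow> 'a \<Rightarrow> complex) \<Rightarrow> ('a \<Rightarrow> complex) \<Rightarrow> 'a \<Rightarrow> ereal" where
  "local_energy H \<phi> q = ereal (Re (H \<phi> q)) / ereal (Re (\<phi> q))"

(* The points where the quotient is meaningful. No value given to 0 / 0 could replace this: a
   function \<phi> whose quotient is 0 / 0 almost everywhere on the support of the eigenfunction
   (such as \<phi> = 0) carries no information about the eigenvalue. *)
definition local_energy_domain ::
    "(('a \<Rightarrow> complex) \<Rightarrow> 'a \<Rightarrow> complex) \<Rightarrow> ('a \<Rightarrow> complex) \<Rightarrow> 'a set" where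
  "local_energy_domain H \<phi> = {q. \<not> (Re (H \<phi> q) = 0 \<and> Re (\<phi> q) = 0)}"

end

theory Submission
  imports Defs
begin

text \<open>
  The mechanism is the orthogonality of \<open>\<Phi>\<^sub>0\<close> to the range of \<open>H - e\<^sub>0\<close>: symmetry
  moves \<open>H\<close> onto the eigenfunction, so \<open>\<langle>\<Phi>\<^sub>0 | H \<phi> - e\<^sub>0 \<phi>\<rangle> = 0\<close> for every \<open>\<phi>\<close> in the domain.
  As \<open>\<Phi>\<^sub>0\<close> is real, the real part of this identity says that the excess
  \<open>g = Re (H \<phi>) - e\<^sub>0 Re \<phi>\<close> has mean zero with respect to the nonnegative weight \<open>\<Phi>\<^sub>0\<close>
  (\<open>eigenfunction_orthogonal_to_excess\<close>).

  Since \<open>Re \<phi> \<ge> 0\<close>, the sign of \<open>g\<close> at a point records on which side of \<open>e\<^sub>0\<close> the local energy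
  lies there, including the points where the local energy is infinite; and \<open>g\<close> vanishes where the
  quotient is \<open>0 / 0\<close>. If the infimum were above \<open>e\<^sub>0\<close>, then \<open>g\<close> would be strictly positive at
  almost every point of the local energy domain. A nonnegative function of weighted mean zero
  vanishes almost everywhere where the weight is positive, so \<open>\<Phi>\<^sub>0\<close> would vanish
  on that domain, against the hypothesis that ties \<open>\<phi>\<close> to the support of \<open>\<Phi>\<^sub>0\<close>. A supremum
  below \<open>e\<^sub>0\<close> is excluded in the same way with \<open>-g\<close>.
\<close>

text \<open>The elementary bound \<open>2 |f| |g| \<le> |f|\<^sup>2 + |g|\<^sup>2\<close> dominates the product.\<close>

lemma L2_inner_integrable:
  assumes "f \<in> L2 M" "g \<in> L2 M"
  shows "integrable M (\<lambda>q. cnj (f q) * g q)"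
proof (rule Bochner_Integration.integrable_bound)
  show "integrable M (\<lambda>q. (cmod (f q))\<^sup>2 + (cmod (g q))\<^sup>2)"
    using assms by (auto simp: L2_def)
  have [measurable]: "f \<in> borel_measurable M" "g \<in> borel_measurable M"
    using assms by (auto simp: L2_def)
  have "(\<lambda>q. cnj (f q)) \<in> borel_measurable M"
    by (rule borel_measurable_continuous_on[OF _ \<open>f \<in> borel_measurable M\<close>])
      (intro continuous_intros)
  then show "(\<lambda>q. cnj (f q) * g q) \<in> borel_measurable M"
    by measurable
  have "cmod (f q) * cmod (g q) \<le> (cmod (f q))\<^sup>2 + (cmod (g q))\<^sup>2" for q
    using sum_squares_bound[of "cmod (f q)" "cmod (g q)"]
      mult_nonneg_nonneg[OF norm_ge_zero norm_ge_zero, of "f q" "g q"]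
    by linarith
  then show "AE q in M. norm (cnj (f q) * g q) \<le> norm ((cmod (f q))\<^sup>2 + (cmod (g q))\<^sup>2)"
    by (simp add: norm_mult)
qed

lemma eigenfunction_orthogonal_to_excess:
  fixes e :: real
  assumes sym: "symmetric_operator M D H"
    and eig: "is_eigenfunction M D H (complex_of_real e) \<Phi>"
    and real: "AE q in M. Im (\<Phi> q) = 0"
    and \<phi>: "\<phi> \<in> D"
  defines "w \<equiv> \<lambda>q. Re (\<Phi> q) * (Re (H \<phi> q) - e * Re (\<phi> q))"
  shows "integrable M w" and "(LINT q|M. w q) = 0"
proof -
  let ?d = "\<lambda>q. cnj (\<Phi> q) * H \<phi> q - of_real e * (cnj (\<Phi> q) * \<phi> q)"
  have op: "L2_operator M D H" and \<Phi>: "\<Phi> \<in> D"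
    using sym eig by (auto simp: symmetric_operator_def is_eigenfunction_def)
  then have L2: "\<Phi> \<in> L2 M" "H \<Phi> \<in> L2 M" "\<phi> \<in> L2 M" "H \<phi> \<in> L2 M"
    using \<phi> unfolding L2_operator_def by auto
  note int = L2_inner_integrable[OF L2(1,4)] L2_inner_integrable[OF L2(1,3)]
  have eq: "AE q in M. H \<Phi> q = of_real e * \<Phi> q"
    using eig by (simp add: is_eigenfunction_def)
  have "L2_inner M \<Phi> (H \<phi>) = (LINT q|M. cnj (H \<Phi> q) * \<phi> q)"
    using sym \<Phi> \<phi> by (simp add: symmetric_operator_def L2_inner_def)
  also have "\<dots> = (LINT q|M. of_real e * (cnj (\<Phi> q) * \<phi> q))"
  proof (rule integral_cong_AE)
    show "(\<lambda>q. cnj (H \<Phi> q) * \<phi> q) \<in> borel_measurable M"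
      by (intro borel_measurable_integrable L2_inner_integrable L2)
    show "(\<lambda>q. of_real e * (cnj (\<Phi> q) * \<phi> q)) \<in> borel_measurable M"
      by (intro borel_measurable_integrable integrable_mult_right int)
    show "AE q in M. cnj (H \<Phi> q) * \<phi> q = of_real e * (cnj (\<Phi> q) * \<phi> q)"
      using eq by eventually_elim simp
  qed
  finally have zero: "(LINT q|M. ?d q) = 0"
    using int by (simp add: L2_inner_def)
  have d: "integrable M ?d"
    using int by (intro Bochner_Integration.integrable_diff integrable_mult_right)
  have "AE q in M. w q = Re (?d q)"
    using real by eventually_elim (simp add: w_def algebra_simps)
  moreover have [measurable]: "w \<in> borel_measurable M"
    using L2 unfolding w_def by (auto simp: L2_def)
  moreover have "(\<lambda>q. Re (?d q)) \<in> borel_measurable M"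
    by (intro borel_measurable_integrable integrable_Re d)
  ultimately have "integrable M w \<longleftrightarrow> integrable M (\<lambda>q. Re (?d q))"
    and "(LINT q|M. w q) = (LINT q|M. Re (?d q))"
    using integrable_cong_AE[of w M "\<lambda>q. Re (?d q)"] integral_cong_AE[of w M "\<lambda>q. Re (?d q)"]
    by blast+
  then show "integrable M w" "(LINT q|M. w q) = 0"
    using integrable_Re[OF d] integral_Re[OF d] zero by auto
qed

lemma weight_vanishes_if_mean_zero:
  fixes w g :: "'a \<Rightarrow> real"
  assumes "integrable M (\<lambda>q. w q * g q)" and "(LINT q|M. w q * g q) = 0"
    and "AE q in M. 0 \<le> w q" and "AE q in M. 0 \<le> g q"
  shows "AE q in M. g q \<noteq> 0 \<longrightarrow> w q = 0"
proof -
  have "AE q in M. 0 \<le> w q * g q"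
    using assms(3,4) by eventually_elim simp
  then have "AE q in M. w q * g q = 0"
    using integral_nonneg_eq_0_iff_AE[OF assms(1)] assms(2) by blast
  then show ?thesis
    by eventually_elim auto
qed

text \<open>
  These two facts also cover \<open>Re (\<phi> q) = 0\<close>: there the local energy is \<open>\<infinity>\<close> or \<open>-\<infinity>\<close>
  according to the sign of \<open>Re (H \<phi> q)\<close>, which is then the whole excess.
\<close>

lemma excess_pos_if_local_energy_greater:
  assumes "q \<in> local_energy_domain H \<phi>" "0 \<le> Re (\<phi> q)" "ereal e < local_energy H \<phi> q"
  shows "0 < Re (H \<phi> q) - e * Re (\<phi> q)"
proof (cases "Re (\<phi> q) = 0")
  case True
  then show ?thesis
    using assms by (cases "Re (H \<phi> q) < 0")
      (auto simp: local_energy_domain_def local_energy_def divide_ereal_def)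
next
  case False
  then show ?thesis
    using assms by (auto simp: local_energy_def less_divide_eq)
qed

lemma excess_neg_if_local_energy_less:
  assumes "q \<in> local_energy_domain H \<phi>" "0 \<le> Re (\<phi> q)" "local_energy H \<phi> q < ereal e"
  shows "Re (H \<phi> q) - e * Re (\<phi> q) < 0"
proof (cases "Re (\<phi> q) = 0")
  case True
  then show ?thesis
    using assms by (cases "Re (H \<phi> q) > 0")
      (auto simp: local_energy_domain_def local_energy_def divide_ereal_def)
next
  case False
  then show ?thesis
    using assms by (auto simp: local_energy_def divide_less_eq)
qed

lemma excess_outside_local_energy_domain:
  assumes "q \<notin> local_energy_domain H \<phi>"
  shows "Re (H \<phi> q) - e * Re (\<phi> q) = 0"
  using assms by (simp add: local_energy_domain_def)

theorem theorem1:
  fixes M :: "'a::t2_space measure"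
    and D :: "('a \<Rightarrow> complex) set"
    and H :: "('a \<Rightarrow> complex) \<Rightarrow> 'a \<Rightarrow> complex"
    and e\<^sub>0 :: real
    and \<Phi>\<^sub>0 :: "'a \<Rightarrow> complex"
  assumes "locally_compact_space (euclidean :: 'a topology)"
    and "radon_measure M"
    and "symmetric_operator M D H"
    and "is_eigenfunction M D H (complex_of_real e\<^sub>0) \<Phi>\<^sub>0"
    and "AE q in M. Im (\<Phi>\<^sub>0 q) = 0 \<and> Re (\<Phi>\<^sub>0 q) \<ge> 0"
  shows "\<forall>\<phi>\<in>D.
           (AE q in M. Re (\<phi> q) \<ge> 0) \<longrightarrow>
           \<not> (AE q in M. q \<in> local_energy_domain H \<phi> \<longrightarrow> \<Phi>\<^sub>0 q = 0) \<longrightarrow>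
           (INF q\<in>local_energy_domain H \<phi>. local_energy H \<phi> q) \<le> ereal e\<^sub>0 \<and>
           ereal e\<^sub>0 \<le> (SUP q\<in>local_energy_domain H \<phi>. local_energy H \<phi> q)"
proof (intro ballI impI)
  fix \<phi>
  assume \<phi>: "\<phi> \<in> D" and pos: "AE q in M. Re (\<phi> q) \<ge> 0"
    and meets: "\<not> (AE q in M. q \<in> local_energy_domain H \<phi> \<longrightarrow> \<Phi>\<^sub>0 q = 0)"
  let ?X = "local_energy_domain H \<phi>" and ?E = "local_energy H \<phi>"
  let ?g = "\<lambda>q. Re (H \<phi> q) - e\<^sub>0 * Re (\<phi> q)"
  have im: "AE q in M. Im (\<Phi>\<^sub>0 q) = 0" and re: "AE q in M. 0 \<le> Re (\<Phi>\<^sub>0 q)"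
    using assms(5) by auto
  note orth = eigenfunction_orthogonal_to_excess[OF assms(3,4) im \<phi>]
  \<comment> \<open>The excess times \<open>s\<close> cannot be positive almost everywhere on the local energy domain;
    \<open>s = 1\<close> serves the infimum and \<open>s = -1\<close> the supremum.\<close>
  have no_sign: False if sign: "AE q in M. q \<in> ?X \<longrightarrow> 0 < s * ?g q" for s :: real
  proof -
    have "AE q in M. s * ?g q \<noteq> 0 \<longrightarrow> Re (\<Phi>\<^sub>0 q) = 0"
    proof (rule weight_vanishes_if_mean_zero[OF _ _ re])
      have eq: "(\<lambda>q. Re (\<Phi>\<^sub>0 q) * (s * ?g q)) = (\<lambda>q. s * (Re (\<Phi>\<^sub>0 q) * ?g q))"
        by (simp add: mult.left_commute)
      show "integrable M (\<lambda>q. Re (\<Phi>\<^sub>0 q) * (s * ?g q))"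
        unfolding eq by (intro integrable_mult_right orth(1))
      show "(LINT q|M. Re (\<Phi>\<^sub>0 q) * (s * ?g q)) = 0"
        unfolding eq using orth(2) by simp
      show "AE q in M. 0 \<le> s * ?g q"
        using sign
      proof eventually_elim
        case (elim q)
        then show ?case
          using excess_outside_local_energy_domain[of q H \<phi> e\<^sub>0] by (cases "q \<in> ?X") auto
      qed
    qed
    with sign im have "AE q in M. q \<in> ?X \<longrightarrow> \<Phi>\<^sub>0 q = 0"
      by eventually_elim (auto simp: complex_eq_iff)
    with meets show False ..
  qed
  show "(INF q\<in>?X. ?E q) \<le> ereal e\<^sub>0 \<and> ereal e\<^sub>0 \<le> (SUP q\<in>?X. ?E q)"
  proof (intro conjI; rule ccontr)
    assume "\<not> (INF q\<in>?X. ?E q) \<le> ereal e\<^sub>0"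
    then have side: "ereal e\<^sub>0 < ?E q" if "q \<in> ?X" for q
      using that by (meson INF_lower less_le_trans not_le)
    have "AE q in M. q \<in> ?X \<longrightarrow> 0 < 1 * ?g q"
      using pos
    proof eventually_elim
      case (elim q)
      then show ?case
        using excess_pos_if_local_energy_greater[OF _ elim side] by simp
    qed
    then show False
      by (rule no_sign)
  next
    assume "\<not> ereal e\<^sub>0 \<le> (SUP q\<in>?X. ?E q)"
    then have side: "?E q < ereal e\<^sub>0" if "q \<in> ?X" for q
      using that by (meson SUP_upper le_less_trans not_le)
    have "AE q in M. q \<in> ?X \<longrightarrow> 0 < (-1) * ?g q"
      using pos
    proof eventually_elim
      case (elim q)
      then show ?case
        using excess_neg_if_local_energy_less[OF _ elim side] by simp
    qed
    then show False
      by (rule no_sign)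
  qed
qed

end
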